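(* Let $f(x)=\sum_{j=0}^n c_jx^j\in\mathbb{C}[x]$ be monic of degree $n\ge 1$ and let $0<\alpha<n$. Let $D_0^{\alpha}f$ be the Riemann-Liouville fractional derivative of $f$ with base point $0$. Then 1. $M(D_0^{\alpha}f)\le \frac{n-\alpha}{n}\lVert f\rVert_1+1$; 2. $M(D_0^{\alpha}f)\le \sqrt{n+1}\,\max\left\{\frac{n-\alpha}{n}\lVert f\rVert_\infty,\,1\right\}$; 3. $M(D_0^{\alpha}f)\le \frac{n-\alpha}{n}\lVert f\rVert_2+1$.
   Context: For $f(x)=\sum_{j=0}^n c_jx^j$ and real $\alpha$, the Riemann-Liouville fractional derivative (differintegral) with base point $0$ is $$D_0^{\alpha}f(x)=\sum_{j=0}^{n} c_j\,\frac{\Gamma(j+1)}{\Gamma(j+1-\alpha)}\,x^{j-\alpha},$$ with the convention $1/\Gamma(s)=0$ for $s\in\{0,-1,-2,\dots\}$, and $x^{j-\alpha}$ computed with the principal branch of the logarithm. The Mahler measure of $D_0^\alpha f$ is $M(D_0^{\alpha}f)=\prod_{z}\max\{1,|z|\}$, the product over the zeros $z$ of $D_0^{\alpha}f$ counted with multiplicity. Zeros at $0$ contribute a factor $1$; the nonzero zeros and their multiplicities are those of the polynomial $\sum_{j=0}^n c_j\frac{j!}{\Gamma(j+1-\alpha)}x^j=x^{\alpha}D_0^{\alpha}f(x)$. Norms: $\lVert f\rVert_\infty=\max_{0\le j\le n}|c_j|$, $\lVert f\rVert_1=\sum_{j=0}^n|c_j|$, $\lVert f\rVert_2=\left(\sum_{j=0}^n|c_j|^2\right)^{1/2}$.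 *)

theory Defs
  imports "HOL-Analysis.Analysis" "HOL-Computational_Algebra.Polynomial"
begin

text \<open>The function \<^term>\<open>rGamma\<close> is the reciprocal Gamma function, so that
  \<^prop>\<open>rGamma s = 0\<close> for \<open>s = 0, -1, -2, \<dots>\<close>. The complex \<^term>\<open>(powr)\<close> uses the
  principal branch of the logarithm; \<open>0 powr b = 0\<close> in HOL, so the definition
  is meaningful for \<open>x \<noteq> 0\<close> only.\<close>

definition RL_deriv :: "real \<Rightarrow> complex poly \<Rightarrow> complex \<Rightarrow> complex" where
  "RL_deriv \<alpha> f x =
     (\<Sum>j\<le>degree f. coeff f j * of_real (Gamma (real j + 1) * rGamma (real j + 1 - \<alpha>))
        * x powr of_real (real j - \<alpha>))"

text \<open>The polynomial \<open>x powr \<alpha> * RL_deriv \<alpha> f x\<close> (see \<open>poly_RL_poly\<close> below).\<close>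

definition RL_poly :: "real \<Rightarrow> complex poly \<Rightarrow> complex poly" where
  "RL_poly \<alpha> f =
     (\<Sum>j\<le>degree f. monom (coeff f j * of_real (fact j * rGamma (real j + 1 - \<alpha>))) j)"

lemma poly_RL_poly:
  assumes "x \<noteq> 0"
  shows "poly (RL_poly \<alpha> f) x = x powr of_real \<alpha> * RL_deriv \<alpha> f x"
proof -
  have "coeff f j * of_real (fact j * rGamma (real j + 1 - \<alpha>)) * x ^ j =
      x powr of_real \<alpha> * (coeff f j * of_real (Gamma (real j + 1) * rGamma (real j + 1 - \<alpha>))
        * x powr of_real (real j - \<alpha>))" for j
  proof -
    have "x ^ j = x powr of_real \<alpha> * x powr of_real (real j - \<alpha>)"
      using assms by (simp flip: powr_add add: powr_nat')
    moreover have "Gamma (real j + 1) = fact j"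
      using Gamma_fact[of j, where 'a = real] by (simp add: add.commute)
    ultimately show ?thesis
      by (simp only: mult_ac)
  qed
  thus ?thesis
    by (simp only: RL_poly_def RL_deriv_def poly_sum poly_monom sum_distrib_left)
qed

lemma RL_deriv_eq_0_iff:
  assumes "x \<noteq> 0"
  shows "RL_deriv \<alpha> f x = 0 \<longleftrightarrow> poly (RL_poly \<alpha> f) x = 0"
  using assms by (simp add: poly_RL_poly)

lemma finite_zeros_RL_deriv:
  assumes "RL_poly \<alpha> f \<noteq> 0"
  shows "finite {z. z \<noteq> 0 \<and> RL_deriv \<alpha> f z = 0}"
  by (rule finite_subset[OF _ poly_roots_finite[OF assms]]) (auto simp: RL_deriv_eq_0_iff)

lemma RL_poly_neq_0:
  assumes "f \<noteq> 0" and "\<alpha> < real (degree f)"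
  shows "RL_poly \<alpha> f \<noteq> 0"
proof -
  let ?n = "degree f"
  have "coeff (RL_poly \<alpha> f) ?n = lead_coeff f * of_real (fact ?n * rGamma (real ?n + 1 - \<alpha>))"
    by (simp add: RL_poly_def coeff_sum)
  moreover have "rGamma (real ?n + 1 - \<alpha>) \<noteq> 0"
    using assms by (auto simp: rGamma_eq_zero_iff elim!: nonpos_Ints_cases)
  ultimately have "coeff (RL_poly \<alpha> f) ?n \<noteq> 0"
    using assms by simp
  thus ?thesis by auto
qed

text \<open>Zeros at \<open>0\<close> would contribute the factor \<open>1\<close> and are left out. The multiplicity
  of a nonzero zero \<open>z\<close> is the one of \<open>x powr \<alpha> * RL_deriv \<alpha> f x\<close>, which differs from
  \<^term>\<open>RL_deriv \<alpha> f\<close> by a factor that is locally (for a suitable branch) holomorphic and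
  nonvanishing. The leading coefficient does not enter.\<close>

definition RL_mahler_measure :: "real \<Rightarrow> complex poly \<Rightarrow> real" where
  "RL_mahler_measure \<alpha> f =
     (\<Prod>z | z \<noteq> 0 \<and> RL_deriv \<alpha> f z = 0. max 1 (norm z) ^ order z (RL_poly \<alpha> f))"

definition poly_norm_inf :: "complex poly \<Rightarrow> real" where
  "poly_norm_inf f = Max ((\<lambda>j. norm (coeff f j)) ` {..degree f})"

definition poly_norm1 :: "complex poly \<Rightarrow> real" where
  "poly_norm1 f = (\<Sum>j\<le>degree f. norm (coeff f j))"

definition poly_norm2 :: "complex poly \<Rightarrow> real" where
  "poly_norm2 f = sqrt (\<Sum>j\<le>degree f. (norm (coeff f j))\<^sup>2)"

end

theory Submission
  imports Defs "HOL-Computational_Algebra.Fundamental_Theorem_Algebra"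
begin

text \<open>Normalise \<open>x\<^sup>\<alpha> D\<^sup>\<alpha> f\<close> to a monic polynomial \<open>g\<close>. By the functional equation of
  Gamma, its coefficient at \<open>j\<close> is \<open>c\<^sub>j\<close> times the product of \<open>(i - \<alpha>) / i\<close> over
  \<open>j < i \<le> n\<close>. The factor \<open>i = n\<close> gives \<open>(n - \<alpha>) / n\<close>, and the remaining product has
  absolute value at most 1, although single factors may exceed 1. All three bounds then
  follow from Landau's inequality \<open>M(g) \<le> \<parallel>g\<parallel>\<^sub>2\<close>, which holds since replacing a linear factor
  \<open>x - z\<close> with \<open>|z| > 1\<close> by \<open>1 - cnj z x\<close> preserves the 2-norm and multiplies the
  leading coefficient by \<open>|z|\<close> in absolute value.\<close>

subsection \<open>Landau's inequality\<close>

lemma poly_norm2_eq_sum_atMost: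
  assumes "degree p \<le> m"
  shows "poly_norm2 p = sqrt (\<Sum>j\<le>m. (norm (coeff p j))\<^sup>2)"
proof -
  have "(\<Sum>j\<le>degree p. (norm (coeff p j))\<^sup>2) = (\<Sum>j\<le>m. (norm (coeff p j))\<^sup>2)"
    using assms by (intro sum.mono_neutral_left) (auto simp: coeff_eq_0)
  thus ?thesis by (simp add: poly_norm2_def)
qed

lemma norm_lead_coeff_le_poly_norm2: "norm (lead_coeff p) \<le> poly_norm2 p"
proof -
  have "(norm (lead_coeff p))\<^sup>2 \<le> (\<Sum>j\<le>degree p. (norm (coeff p j))\<^sup>2)"
    by (rule member_le_sum) auto
  thus ?thesis by (simp add: poly_norm2_def real_le_rsqrt)
qed

text \<open>Both squares contain the same cross term, twice the real part of
  \<open>a * cnj (z * b)\<close>, which cancels.\<close>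

lemma norm_diff_mult_swap:
  "(norm (a - z * b))\<^sup>2 - (norm (b - cnj z * a))\<^sup>2 =
     (1 - (norm z)\<^sup>2) * ((norm a)\<^sup>2 - (norm b)\<^sup>2)"
  by (simp only: cmod_power2) (simp add: algebra_simps power2_eq_square)

lemma poly_norm2_reflect_factor:
  "poly_norm2 ([:- z, 1:] * q) = poly_norm2 ([:1, - cnj z:] * q)"
proof -
  let ?m = "Suc (degree q)"
  let ?p = "pCons 0 q"
  have coeffs: "coeff ([:- z, 1:] * q) j = coeff ?p j - z * coeff q j"
    "coeff ([:1, - cnj z:] * q) j = coeff q j - cnj z * coeff ?p j" for j
    by (simp_all add: coeff_pCons split: nat.splits)
  \<comment> \<open>The two products can differ in degree when \<open>z = 0\<close>, so both norms
    are summed up to the common bound \<open>?m\<close>.\<close>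
  have deg: "degree ([:a, b:] * q) \<le> ?m" for a b :: complex
    using degree_mult_le[of "[:a, b:]" q] degree_pCons_le[of a "[:b:]"] by simp
  \<comment> \<open>Multiplication by x only shifts coefficients, so the differences from
    \<open>norm_diff_mult_swap\<close> sum to 0.\<close>
  have "(\<Sum>j\<le>?m. (norm (coeff ?p j))\<^sup>2) = (\<Sum>j\<le>degree q. (norm (coeff q j))\<^sup>2)"
    by (subst sum.atMost_Suc_shift) simp
  also have "\<dots> = (\<Sum>j\<le>?m. (norm (coeff q j))\<^sup>2)"
    by (simp add: coeff_eq_0)
  finally have "(\<Sum>j\<le>?m. (1 - (norm z)\<^sup>2) * ((norm (coeff ?p j))\<^sup>2 - (norm (coeff q j))\<^sup>2)) = 0"
    by (simp only: sum_distrib_left[symmetric] sum_subtractf) simp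
  hence "(\<Sum>j\<le>?m. (norm (coeff ([:- z, 1:] * q) j))\<^sup>2)
      = (\<Sum>j\<le>?m. (norm (coeff ([:1, - cnj z:] * q) j))\<^sup>2)"
    by (simp only: coeffs norm_diff_mult_swap[symmetric] sum_subtractf right_minus_eq)
  thus ?thesis
    by (simp only: poly_norm2_eq_sum_atMost[OF deg])
qed

text \<open>The cofactor \<open>h\<close> is arbitrary so that the induction can absorb each linear
  factor into it: unchanged if \<open>norm z \<le> 1\<close>, reflected otherwise.\<close>

lemma landau_inequality_factors:
  "norm (lead_coeff h) * (\<Prod>z\<in>#A. max 1 (norm z))
     \<le> poly_norm2 (h * (\<Prod>z\<in>#A. [:- z, 1:]))"
proof (induction A arbitrary: h)
  case empty
  show ?case by (simp add: norm_lead_coeff_le_poly_norm2)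
next
  case (add z A)
  let ?P = "\<Prod>z\<in>#A. [:- z, 1:]"
  show ?case
  proof (cases "norm z \<le> 1")
    case True
    have "lead_coeff ([:- z, 1:] * h) = lead_coeff h"
      by (simp add: lead_coeff_mult del: mult_pCons_left)
    with add.IH[of "[:- z, 1:] * h"] True show ?thesis
      by (simp only: image_mset_add_mset prod_mset.add_mset max_absorb1 mult_1_left mult_ac)
  next
    case False
    hence "lead_coeff ([:1, - cnj z:] * h) = - cnj z * lead_coeff h"
      by (subst lead_coeff_mult) auto
    hence "norm (lead_coeff h) * (norm z * (\<Prod>z\<in>#A. max 1 (norm z)))
        \<le> poly_norm2 (([:1, - cnj z:] * h) * ?P)"
      using add.IH[of "[:1, - cnj z:] * h"] by (simp only: norm_mult) (simp add: mult_ac)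
    also have "\<dots> = poly_norm2 (h * ([:- z, 1:] * ?P))"
      using poly_norm2_reflect_factor[of z "h * ?P"] by (simp only: mult_ac)
    finally show ?thesis
      using False by simp
  qed
qed

theorem landau_inequality:
  assumes "p \<noteq> 0"
  shows "norm (lead_coeff p) * (\<Prod>z | poly p z = 0. max 1 (norm z) ^ order z p) \<le> poly_norm2 p"
proof -
  have "p = [:lead_coeff p:] * (\<Prod>z\<in>#proots p. [:- z, 1:])"
    using complex_poly_decompose_multiset[of p] assms by simp
  moreover have "(\<Prod>z\<in>#proots p. max 1 (norm z)) =
      (\<Prod>z | poly p z = 0. max 1 (norm z) ^ order z p)"
    using assms by (simp add: image_prod_mset_multiplicity)
  ultimately show ?thesis
    using landau_inequality_factors[of "[:lead_coeff p:]" "proots p"] by simp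
qed

subsection \<open>The coefficients of the fractional derivative\<close>

lemma prod_abs_shift_div_le_1:
  fixes \<alpha> :: real
  assumes "0 < \<alpha>" and "\<alpha> < real m + 1"
  shows "(\<Prod>i=1..m. \<bar>real i - \<alpha>\<bar> / real i) \<le> 1"
  using assms
proof (induction m)
  case (Suc m)
  show ?case
  proof (cases "\<alpha> < real m + 1")
    case True
    with Suc have "(\<Prod>i=1..m. \<bar>real i - \<alpha>\<bar> / real i) * (\<bar>real (Suc m) - \<alpha>\<bar> / real (Suc m)) \<le> 1 * 1"
      by (intro mult_mono) (auto simp: field_simps intro!: prod_nonneg)
    thus ?thesis by simp
  next
    case False
    \<comment> \<open>Here m + 1 \<le> \<alpha> < m + 2, so |i - \<alpha>| \<le> m + 2 - i, and
      these numerators are a permutation of the denominators.\<close>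
    have "(\<Prod>i=1..Suc m. \<bar>real i - \<alpha>\<bar> / real i) \<le> (\<Prod>i=1..Suc m. real (Suc (Suc m) - i) / real i)"
      using False Suc.prems by (intro prod_mono conjI divide_right_mono) (auto simp: of_nat_diff)
    also have "\<dots> = (\<Prod>i=1..Suc m. real (Suc (Suc m) - i)) / (\<Prod>i=1..Suc m. real i)"
      by (rule prod_dividef)
    also have "(\<Prod>i=1..Suc m. real (Suc (Suc m) - i)) = (\<Prod>i=1..Suc m. real i)"
      by (rule prod.reindex_bij_witness[of _ "\<lambda>i. Suc (Suc m) - i" "\<lambda>i. Suc (Suc m) - i"]) auto
    also have "\<dots> / \<dots> = 1" by simp
    finally show ?thesis .
  qed
qed simp

text \<open>A factor exceeds 1 exactly when \<open>2 i < \<alpha>\<close>, so the omitted factors either all are at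
  least 1, or else all remaining ones are at most 1.\<close>

lemma prod_abs_shift_div_tail_le_1:
  fixes \<alpha> :: real
  assumes "0 < \<alpha>" and "\<alpha> < real m + 1" and "j \<le> m"
  shows "(\<Prod>i=Suc j..m. \<bar>real i - \<alpha>\<bar> / real i) \<le> 1"
proof (cases "\<alpha> \<le> 2 * real (Suc j)")
  case True
  thus ?thesis using assms
    by (intro prod_le_1) (auto simp: field_simps abs_le_iff)
next
  case False
  have "1 * (\<Prod>i=Suc j..m. \<bar>real i - \<alpha>\<bar> / real i) \<le>
      (\<Prod>i=1..j. \<bar>real i - \<alpha>\<bar> / real i) * (\<Prod>i=Suc j..m. \<bar>real i - \<alpha>\<bar> / real i)"
    using False by (intro mult_right_mono prod_ge_1 prod_nonneg) (auto simp: field_simps)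
  also have "\<dots> = (\<Prod>i=1..m. \<bar>real i - \<alpha>\<bar> / real i)"
    using prod.ub_add_nat[of 1 j "\<lambda>i. \<bar>real i - \<alpha>\<bar> / real i" "m - j"] assms by simp
  also have "\<dots> \<le> 1"
    using assms by (intro prod_abs_shift_div_le_1)
  finally show ?thesis by simp
qed

text \<open>This iterates \<open>rGamma s = s * rGamma (s + 1)\<close>, which holds at every
  \<open>s\<close>; integer \<alpha>, where Gamma may have poles, needs no separate case.\<close>

lemma fact_rGamma_shift:
  fixes \<alpha> :: real
  assumes "j \<le> n"
  shows "fact j * rGamma (real j + 1 - \<alpha>) =
    fact n * rGamma (real n + 1 - \<alpha>) * (\<Prod>i=Suc j..n. (real i - \<alpha>) / real i)"
  using assms
proof (induction n rule: dec_induct)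
  case (step n)
  have rec: "rGamma (real n + 1 - \<alpha>) = (real (Suc n) - \<alpha>) * rGamma (real (Suc n) + 1 - \<alpha>)"
    using rGamma_plus1[of "real (Suc n) - \<alpha>"] by (simp add: algebra_simps)
  let ?R = "rGamma (real (Suc n) + 1 - \<alpha>)" and ?P = "\<Prod>i=Suc j..n. (real i - \<alpha>) / real i"
  have "fact j * rGamma (real j + 1 - \<alpha>) =
      fact n * real (Suc n) * ?R * (?P * ((real (Suc n) - \<alpha>) / real (Suc n)))"
    unfolding step.IH rec by simp
  also have "fact n * real (Suc n) = fact (Suc n)" by simp
  also have "?P * ((real (Suc n) - \<alpha>) / real (Suc n)) =
      (\<Prod>i=Suc j..Suc n. (real i - \<alpha>) / real i)"
    using step.hyps by simp
  finally show ?case .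
qed simp

lemma abs_fact_rGamma_le:
  fixes \<alpha> :: real
  assumes "0 < \<alpha>" and "\<alpha> < real n" and "j < n"
  shows "\<bar>fact j * rGamma (real j + 1 - \<alpha>)\<bar>
    \<le> \<bar>fact n * rGamma (real n + 1 - \<alpha>)\<bar> * ((real n - \<alpha>) / real n)"
proof -
  \<comment> \<open>Splitting off the factor i = n leaves a product up to m, and \<alpha> < n is the
    bound \<alpha> < m + 1 that the tail lemma requires.\<close>
  obtain m where m: "n = Suc m" using assms by (cases n) auto
  have "(\<Prod>i=Suc j..n. \<bar>real i - \<alpha>\<bar> / real i) =
      (\<Prod>i=Suc j..m. \<bar>real i - \<alpha>\<bar> / real i) * ((real n - \<alpha>) / real n)"
    using assms by (simp add: m)
  also have "\<dots> \<le> 1 * ((real n - \<alpha>) / real n)"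
    using assms m by (intro mult_right_mono prod_abs_shift_div_tail_le_1) auto
  finally have "\<bar>\<Prod>i=Suc j..n. (real i - \<alpha>) / real i\<bar> \<le> (real n - \<alpha>) / real n"
    by (simp add: abs_prod)
  thus ?thesis
    unfolding fact_rGamma_shift[OF less_imp_le[OF \<open>j < n\<close>]] abs_mult[of "_ * _"]
    by (intro mult_left_mono) auto
qed

lemma coeff_RL_poly:
  "coeff (RL_poly \<alpha> f) j = coeff f j * of_real (fact j * rGamma (real j + 1 - \<alpha>))"
proof -
  have "coeff (RL_poly \<alpha> f) j =
      (if j \<le> degree f then coeff f j * of_real (fact j * rGamma (real j + 1 - \<alpha>)) else 0)"
    by (simp add: RL_poly_def coeff_sum)
  thus ?thesis by (simp add: coeff_eq_0)
qed

lemma degree_RL_poly_le: "degree (RL_poly \<alpha> f) \<le> degree f"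
  by (rule degree_le) (simp add: coeff_RL_poly coeff_eq_0)

section \<open>From the coefficient bounds to the Mahler measure\<close>

lemma RL_mahler_measure_eq:
  assumes "RL_poly \<alpha> f \<noteq> 0"
  shows "RL_mahler_measure \<alpha> f =
    (\<Prod>z | poly (RL_poly \<alpha> f) z = 0. max 1 (norm z) ^ order z (RL_poly \<alpha> f))"
proof -
  have nonzero: "{z. z \<noteq> 0 \<and> RL_deriv \<alpha> f z = 0} = {z. poly (RL_poly \<alpha> f) z = 0} - {0}"
    by (auto simp: RL_deriv_eq_0_iff)
  show ?thesis
    unfolding RL_mahler_measure_def nonzero
    \<comment> \<open>A root at 0 contributes a power of \<open>max 1 0 = 1\<close>.\<close>
    by (rule prod.mono_neutral_left) (use poly_roots_finite[OF assms] in auto)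
qed

text \<open>The common source of all three bounds; the summand 1 comes from the leading coefficient,
  to which the factor (n - \<alpha>) / n does not apply.\<close>

lemma RL_mahler_measure_le:
  assumes "lead_coeff f = 1" and "0 < \<alpha>" and "\<alpha> < real (degree f)"
  defines "n \<equiv> degree f"
  shows "RL_mahler_measure \<alpha> f
    \<le> sqrt ((\<Sum>j<n. ((real n - \<alpha>) / real n * norm (coeff f j))\<^sup>2) + 1)"
proof -
  define p where "p = RL_poly \<alpha> f"
  define L where "L = \<bar>fact n * rGamma (real n + 1 - \<alpha>)\<bar>"
  let ?\<beta> = "(real n - \<alpha>) / real n"
  have p: "p \<noteq> 0"
    unfolding p_def using assms by (intro RL_poly_neq_0) auto
  have top: "norm (coeff p n) = L"
    using assms by (simp add: p_def coeff_RL_poly L_def norm_mult abs_mult del: of_real_mult)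
  have "rGamma (real n + 1 - \<alpha>) \<noteq> 0"
    using assms by (auto simp: rGamma_eq_zero_iff elim!: nonpos_Ints_cases)
  hence L: "L > 0" by (simp add: L_def)
  have deg: "degree p = n"
    using top L degree_RL_poly_le[of \<alpha> f] le_degree[of p n] by (force simp: p_def n_def)
  have le: "norm (coeff p j) \<le> L * (?\<beta> * norm (coeff f j))" if "j < n" for j
  proof -
    have "norm (coeff p j) = norm (coeff f j) * \<bar>fact j * rGamma (real j + 1 - \<alpha>)\<bar>"
      by (simp only: p_def coeff_RL_poly norm_mult norm_of_real)
    also have "\<dots> \<le> norm (coeff f j) * (L * ?\<beta>)"
      unfolding L_def using assms that by (intro mult_left_mono abs_fact_rGamma_le) auto
    finally show ?thesis by (simp add: mult_ac)
  qed
  have "L * RL_mahler_measure \<alpha> f \<le> poly_norm2 p"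
    using landau_inequality[OF p] RL_mahler_measure_eq[of \<alpha> f] p top deg
    by (simp add: p_def)
  also have "\<dots> = sqrt ((\<Sum>j<n. (norm (coeff p j))\<^sup>2) + L\<^sup>2)"
    by (simp add: poly_norm2_def deg top flip: lessThan_Suc_atMost)
  also have "\<dots> \<le> sqrt ((\<Sum>j<n. (L * (?\<beta> * norm (coeff f j)))\<^sup>2) + L\<^sup>2)"
    by (intro real_sqrt_le_mono add_mono sum_mono power_mono order.refl le) auto
  also have "(\<Sum>j<n. (L * (?\<beta> * norm (coeff f j)))\<^sup>2) + L\<^sup>2 =
      L\<^sup>2 * ((\<Sum>j<n. (?\<beta> * norm (coeff f j))\<^sup>2) + 1)"
    by (simp only: power_mult_distrib[of L] sum_distrib_left[symmetric] distrib_left mult_1_right)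
  also have "sqrt \<dots> = L * sqrt ((\<Sum>j<n. (?\<beta> * norm (coeff f j))\<^sup>2) + 1)"
    using L by (simp add: real_sqrt_mult)
  finally show ?thesis using L by simp
qed

theorem theorem5p3:
  fixes f :: "complex poly" and n :: nat and \<alpha> :: real
  assumes "degree f = n" and "lead_coeff f = 1" and "n \<ge> 1"
    and "0 < \<alpha>" and "\<alpha> < real n"
  shows "RL_mahler_measure \<alpha> f \<le> (real n - \<alpha>) / real n * poly_norm1 f + 1 \<and>
    RL_mahler_measure \<alpha> f
      \<le> sqrt (real n + 1) * max ((real n - \<alpha>) / real n * poly_norm_inf f) 1 \<and>
    RL_mahler_measure \<alpha> f \<le> (real n - \<alpha>) / real n * poly_norm2 f + 1"
proof -
  define \<beta> where "\<beta> = (real n - \<alpha>) / real n"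
  define S where "S = (\<Sum>j<n. (\<beta> * norm (coeff f j))\<^sup>2)"
  have \<beta>: "\<beta> \<ge> 0" using assms by (simp add: \<beta>_def)
  have M: "RL_mahler_measure \<alpha> f \<le> sqrt (S + 1)"
    using RL_mahler_measure_le[of f \<alpha>] assms by (simp add: S_def \<beta>_def)
  have norm2: "sqrt S \<le> \<beta> * poly_norm2 f"
  proof -
    have "S \<le> (\<Sum>j\<le>n. (\<beta> * norm (coeff f j))\<^sup>2)"
      unfolding S_def by (intro sum_mono2) auto
    also have "sqrt \<dots> = \<beta> * poly_norm2 f"
      using \<beta> assms(1)
      by (simp add: poly_norm2_def power_mult_distrib real_sqrt_mult flip: sum_distrib_left)
    finally show ?thesis by simp
  qed
  have "S \<ge> 0" by (simp add: S_def sum_nonneg)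
  hence M3: "RL_mahler_measure \<alpha> f \<le> \<beta> * poly_norm2 f + 1"
    using M sqrt_add_le_add_sqrt[of S 1] norm2 by simp
  \<comment> \<open>The first bound is a weakening of the third.\<close>
  have "poly_norm2 f \<le> poly_norm1 f"
    using L2_set_le_sum[of "{..degree f}" "\<lambda>j. norm (coeff f j)"]
    by (simp add: poly_norm2_def poly_norm1_def L2_set_def)
  with \<beta> M3 have M1: "RL_mahler_measure \<alpha> f \<le> \<beta> * poly_norm1 f + 1"
    using mult_left_mono[of "poly_norm2 f" "poly_norm1 f" \<beta>] by simp
  define K where "K = max (\<beta> * poly_norm_inf f) 1"
  \<comment> \<open>The maximum with 1 lets \<open>K\<close> dominate the leading term too, so S + 1
    consists of n + 1 terms, each at most \<open>K\<^sup>2\<close>.\<close>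
  have "S \<le> (\<Sum>j<n. K\<^sup>2)"
    unfolding S_def
  proof (intro sum_mono power_mono)
    fix j assume "j \<in> {..<n}"
    hence "norm (coeff f j) \<le> poly_norm_inf f"
      unfolding poly_norm_inf_def using assms(1) by (intro Max_ge) auto
    with \<beta> have "\<beta> * norm (coeff f j) \<le> \<beta> * poly_norm_inf f"
      by (rule mult_left_mono[rotated])
    thus "\<beta> * norm (coeff f j) \<le> K" by (simp add: K_def)
  qed (use \<beta> in auto)
  moreover have "1 \<le> K\<^sup>2" "0 \<le> K" by (auto simp: K_def)
  ultimately have "S + 1 \<le> (real n + 1) * K\<^sup>2"
    by (simp add: algebra_simps)
  hence "sqrt (S + 1) \<le> sqrt (real n + 1) * K"
    using \<open>0 \<le> K\<close> by (metis real_sqrt_le_mono real_sqrt_mult real_sqrt_abs abs_of_nonneg)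
  with M have "RL_mahler_measure \<alpha> f \<le> sqrt (real n + 1) * K" by simp
  with M1 M3 show ?thesis by (simp add: \<beta>_def K_def)
qed

end
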